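(* Let $X$ be a Banach space over $\mathbb{K}\in\{\mathbb{R},\mathbb{C}\}$, let $\Lambda$ be a nonempty set, and let $X_\lambda$, $\lambda\in\Lambda$, be closed linear subspaces of $X$ forming an absolutely representing family of subspaces (ARFS) in $X$. Then there exists $R>0$ with the following property: if $\widetilde{X}_\lambda$, $\lambda\in\Lambda$, are closed linear subspaces of $X$ with $$\sup_{\lambda\in\Lambda}\rho_0(X_\lambda,\widetilde{X}_\lambda)<R,$$ then the family $(\widetilde{X}_\lambda)_{\lambda\in\Lambda}$ is an ARFS in $X$.
   Context: A family $(X_\lambda)_{\lambda\in\Lambda}$ of closed linear subspaces of $X$ is called an absolutely representing family of subspaces (ARFS) in $X$ if for every $x\in X$ there exist $x_\lambda\in X_\lambda$, $\lambda\in\Lambda$, such that $\sum_{\lambda\in\Lambda}\|x_\lambda\|<\infty$ and $x=\sum_{\lambda\in\Lambda}x_\lambda$. For closed linear subspaces $Y,Z\subset X$, $\rho_0(Y,Z)=\sup\{d(y,Z)\mid y\in Y,\ \|y\|=1\}$, where $d(y,Z)=\inf_{z\in Z}\|y-z\|$; if $Y=\{0\}$, then $\rho_0(Y,Z)=0$. *)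

theory Defs
  imports "HOL-Analysis.Analysis"
begin

(* A Banach space over the scalar field 'k.  The library's class banach only provides the real
   structure; smul is the multiplication by scalars from 'k, of which that real structure is the
   restriction to the reals.  By the Gelfand-Mazur theorem the reals and the complex numbers, with
   their usual absolute values, are up to isomorphism the only types of class real_normed_field, so
   'k is exactly a scalar field that is real or complex. *)
locale banach_space_over = vector_space smul
  for smul :: "'k::real_normed_field \<Rightarrow> 'a::banach \<Rightarrow> 'a" +
  assumes scale_of_real: "smul (of_real r) x = r *\<^sub>R x"
    and norm_scale: "norm (smul c x) = norm c * norm x"

lemma banach_space_over_real:
  "banach_space_over (scaleR :: real \<Rightarrow> 'a::banach \<Rightarrow> 'a)"
  by unfold_locales (auto simp: algebra_simps)

lemma banach_space_over_complex:
  "banach_space_over ((*) :: complex \<Rightarrow> complex \<Rightarrow> complex)"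
  by unfold_locales (auto simp: algebra_simps norm_mult scaleR_conv_of_real)

definition closed_subspace ::
    "('k::real_normed_field \<Rightarrow> 'a::banach \<Rightarrow> 'a) \<Rightarrow> 'a set \<Rightarrow> bool" where
  "closed_subspace smul Y \<longleftrightarrow> module.subspace smul Y \<and> closed Y"

(* Absolutely representing families of subspaces.  The index set may be uncountable, so the sums
   are the unordered ones. *)
definition arfs ::
    "('k::real_normed_field \<Rightarrow> 'a::banach \<Rightarrow> 'a) \<Rightarrow> 'i set \<Rightarrow> ('i \<Rightarrow> 'a set) \<Rightarrow> bool" where
  "arfs smul \<Lambda> X \<longleftrightarrow>
     (\<forall>l\<in>\<Lambda>. closed_subspace smul (X l)) \<and>
     (\<forall>x. \<exists>u. (\<forall>l\<in>\<Lambda>. u l \<in> X l) \<and> (\<lambda>l. norm (u l)) summable_on \<Lambda> \<and> (u has_sum x) \<Lambda>)"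

(* For subspaces Y and Z the set of distances is contained in [0, 1] and, unless Y = {0}, nonempty,
   so the supremum in the reals is the true one. *)
definition rho0 :: "'a::real_normed_vector set \<Rightarrow> 'a set \<Rightarrow> real" where
  "rho0 Y Z = (if Y = {0} then 0 else (SUP y\<in>{y \<in> Y. norm y = 1}. infdist y Z))"

end

(* By the Baire category theorem, the X_l admit representations of norm at most C * norm x.  If the
   subspaces X'_l are r-close to the X_l with r * C < 1, moving every term of such a representation
   into X'_l represents x up to an error of norm at most r * C * norm x, and the errors of successive
   corrections decay geometrically.  The same iteration turns the density statement given by Baire
   into exact representations, so the l1-sum of the subspaces and the open mapping theorem are not
   needed. *)
theory Submission
  imports Defs
begin

section \<open>Absolutely convergent representations with a norm bound\<close>

text \<open>In terms of the l1-sum of the \<open>X l\<close>, this says that the summation map sends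
  some element of norm at most \<open>B\<close> to \<open>x\<close>. Carrying the bound along makes
  the estimates quantitative.\<close>

definition abs_rep :: "'i set \<Rightarrow> ('i \<Rightarrow> 'a::real_normed_vector set) \<Rightarrow> 'a \<Rightarrow> real \<Rightarrow> bool" where
  "abs_rep \<Lambda> X x B \<longleftrightarrow>
     (\<exists>u. (\<forall>l\<in>\<Lambda>. u l \<in> X l) \<and> (\<lambda>l. norm (u l)) summable_on \<Lambda> \<and>
          (\<Sum>\<^sub>\<infinity>l\<in>\<Lambda>. norm (u l)) \<le> B \<and> (u has_sum x) \<Lambda>)"

lemma abs_repI:
  assumes "\<And>l. l \<in> \<Lambda> \<Longrightarrow> u l \<in> X l" "(\<lambda>l. norm (u l)) summable_on \<Lambda>"
    and "(\<Sum>\<^sub>\<infinity>l\<in>\<Lambda>. norm (u l)) \<le> B" "(u has_sum x) \<Lambda>"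
  shows "abs_rep \<Lambda> X x B"
  using assms unfolding abs_rep_def by blast

lemma abs_rep_mono: "abs_rep \<Lambda> X x A \<Longrightarrow> A \<le> B \<Longrightarrow> abs_rep \<Lambda> X x B"
  by (force simp: abs_rep_def)

lemma abs_rep_diff:
  assumes sub: "\<And>l. l \<in> \<Lambda> \<Longrightarrow> subspace (X l)"
    and "abs_rep \<Lambda> X x A" "abs_rep \<Lambda> X y B"
  shows "abs_rep \<Lambda> X (x - y) (A + B)"
proof -
  obtain u where u: "\<And>l. l \<in> \<Lambda> \<Longrightarrow> u l \<in> X l" "(\<lambda>l. norm (u l)) summable_on \<Lambda>"
    "(\<Sum>\<^sub>\<infinity>l\<in>\<Lambda>. norm (u l)) \<le> A" "(u has_sum x) \<Lambda>"
    using assms(2) unfolding abs_rep_def by blast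
  obtain v where v: "\<And>l. l \<in> \<Lambda> \<Longrightarrow> v l \<in> X l" "(\<lambda>l. norm (v l)) summable_on \<Lambda>"
    "(\<Sum>\<^sub>\<infinity>l\<in>\<Lambda>. norm (v l)) \<le> B" "(v has_sum y) \<Lambda>"
    using assms(3) unfolding abs_rep_def by blast
  have s: "(\<lambda>l. norm (u l) + norm (v l)) summable_on \<Lambda>"
    using u(2) v(2) by (rule summable_on_add)
  have d: "(\<lambda>l. norm (u l - v l)) summable_on \<Lambda>"
    by (rule Infinite_Sum.abs_summable_on_comparison_test'[OF s]) (rule norm_triangle_ineq4)
  show ?thesis
  proof (rule abs_repI)
    show "u l - v l \<in> X l" if "l \<in> \<Lambda>" for l
      using that u(1) v(1) sub subspace_diff by blast
    have "(\<Sum>\<^sub>\<infinity>l\<in>\<Lambda>. norm (u l - v l)) \<le> (\<Sum>\<^sub>\<infinity>l\<in>\<Lambda>. norm (u l) + norm (v l))"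
      by (rule infsum_mono[OF d s]) (rule norm_triangle_ineq4)
    also have "\<dots> \<le> A + B"
      using u(2,3) v(2,3) by (simp add: infsum_add)
    finally show "(\<Sum>\<^sub>\<infinity>l\<in>\<Lambda>. norm (u l - v l)) \<le> A + B" .
    show "((\<lambda>l. u l - v l) has_sum (x - y)) \<Lambda>"
      using has_sum_add[OF u(4) has_sum_scaleR[OF v(4), of "-1"]] by simp
  qed (rule d)
qed

lemma abs_rep_scaleR:
  assumes sub: "\<And>l. l \<in> \<Lambda> \<Longrightarrow> subspace (X l)"
    and "abs_rep \<Lambda> X x A" "c \<ge> 0"
  shows "abs_rep \<Lambda> X (c *\<^sub>R x) (c * A)"
proof -
  obtain u where u: "\<And>l. l \<in> \<Lambda> \<Longrightarrow> u l \<in> X l" "(\<lambda>l. norm (u l)) summable_on \<Lambda>"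
    "(\<Sum>\<^sub>\<infinity>l\<in>\<Lambda>. norm (u l)) \<le> A" "(u has_sum x) \<Lambda>"
    using assms(2) unfolding abs_rep_def by blast
  show ?thesis
  proof (rule abs_repI)
    show "c *\<^sub>R u l \<in> X l" if "l \<in> \<Lambda>" for l
      using that u(1) sub subspace_scale by blast
    show "(\<lambda>l. norm (c *\<^sub>R u l)) summable_on \<Lambda>"
      using u(2) by (simp add: summable_on_cmult_right)
    show "(\<Sum>\<^sub>\<infinity>l\<in>\<Lambda>. norm (c *\<^sub>R u l)) \<le> c * A"
      using u(2,3) \<open>c \<ge> 0\<close> by (simp add: infsum_cmult_right mult_left_mono)
    show "((\<lambda>l. c *\<^sub>R u l) has_sum (c *\<^sub>R x)) \<Lambda>"
      using u(4) by (rule has_sum_scaleR)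
  qed
qed

lemma abs_rep_zero:
  assumes "\<And>l. l \<in> \<Lambda> \<Longrightarrow> subspace (X l)"
  shows "abs_rep \<Lambda> X 0 0"
  by (rule abs_repI[where u = "\<lambda>_. 0"]) (use assms subspace_0 in auto)

section \<open>Series of representations and successive approximation\<close>

lemma has_sum_in_closed_subspace:
  assumes "subspace Y" "closed Y" "\<And>n. n \<in> A \<Longrightarrow> f n \<in> Y" "(f has_sum x) A"
  shows "x \<in> Y"
proof (rule Lim_in_closed_set)
  show "(sum f \<longlongrightarrow> x) (finite_subsets_at_top A)"
    using assms(4) by (simp add: has_sum_def)
  show "eventually (\<lambda>F. sum f F \<in> Y) (finite_subsets_at_top A)"
    by (rule eventually_finite_subsets_at_top_weakI) (use assms in \<open>auto intro!: subspace_sum\<close>)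
qed (use assms in auto)

text \<open>Representations of the \<open>y n\<close> form a double family over pairs
  \<open>(n, l)\<close> that is absolutely summable, because its row norms are dominated by
  \<open>B\<close>. Summing it along \<open>n\<close> first gives the terms of a representation of
  \<open>x\<close>; closedness keeps these terms in \<open>X l\<close>.\<close>

lemma abs_rep_suminf:
  fixes X :: "'i \<Rightarrow> 'a::banach set"
  assumes sub: "\<And>l. l \<in> \<Lambda> \<Longrightarrow> subspace (X l)" and cl: "\<And>l. l \<in> \<Lambda> \<Longrightarrow> closed (X l)"
    and rep: "\<And>n::nat. abs_rep \<Lambda> X (y n) (B n)"
    and B: "B sums S" and y: "y sums x"
  shows "abs_rep \<Lambda> X x S"
proof -
  have "\<exists>u. (\<forall>l\<in>\<Lambda>. u l \<in> X l) \<and> (\<lambda>l. norm (u l)) summable_on \<Lambda> \<and>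
          (\<Sum>\<^sub>\<infinity>l\<in>\<Lambda>. norm (u l)) \<le> B n \<and> (u has_sum y n) \<Lambda>" for n
    using rep[of n] unfolding abs_rep_def .
  then obtain v where v: "\<And>n l. l \<in> \<Lambda> \<Longrightarrow> v n l \<in> X l" "\<And>n. (\<lambda>l. norm (v n l)) summable_on \<Lambda>"
    "\<And>n. (\<Sum>\<^sub>\<infinity>l\<in>\<Lambda>. norm (v n l)) \<le> B n" "\<And>n. (v n has_sum y n) \<Lambda>"
    by metis
  have nonneg: "0 \<le> (\<Sum>\<^sub>\<infinity>l\<in>\<Lambda>. norm (v n l))" for n
    by (rule infsum_nonneg) simp
  \<comment> \<open>Each \<open>B n\<close> bounds a sum of norms. Nonnegativity turns the ordered
    series \<open>B sums S\<close> into an unordered sum.\<close>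
  have B0: "0 \<le> B n" for n
    using nonneg[of n] v(3)[of n] by linarith
  have Bsum: "(B has_sum S) UNIV"
    by (rule norm_summable_imp_has_sum) (use B B0 sums_summable in auto)
  have N: "(\<lambda>n. \<Sum>\<^sub>\<infinity>l\<in>\<Lambda>. norm (v n l)) summable_on UNIV"
    by (rule summable_on_comparison_test[of B]) (use Bsum v(3) nonneg in \<open>auto simp: summable_on_def\<close>)
  have abs: "(\<lambda>p. norm (case p of (n, l) \<Rightarrow> v n l)) summable_on UNIV \<times> \<Lambda>"
    unfolding Infinite_Sum.abs_summable_on_Sigma_iff using v(2) N nonneg by simp
  have abs': "(\<lambda>p. norm (case p of (l, n) \<Rightarrow> v n l)) summable_on \<Lambda> \<times> UNIV"
    using abs summable_on_swap[of "\<lambda>p. norm (case p of (n, l) \<Rightarrow> v n l)" UNIV \<Lambda>]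
    by (simp add: case_prod_unfold)
  have abs_l: "(\<lambda>n. norm (v n l)) summable_on UNIV" if "l \<in> \<Lambda>" for l
    using abs' that unfolding Infinite_Sum.abs_summable_on_Sigma_iff by auto
  have inner: "((\<lambda>n. v n l) has_sum (\<Sum>\<^sub>\<infinity>n. v n l)) UNIV" if "l \<in> \<Lambda>" for l
    using abs_summable_summable[OF abs_l[OF that]] by (rule has_sum_infsum)
  have outer: "(\<lambda>l. \<Sum>\<^sub>\<infinity>n. norm (v n l)) summable_on \<Lambda>"
  proof -
    have "(\<lambda>l. norm (\<Sum>\<^sub>\<infinity>n. norm (v n l))) summable_on \<Lambda>"
      using abs' unfolding Infinite_Sum.abs_summable_on_Sigma_iff by auto
    then show ?thesis by (rule abs_summable_summable)
  qed
  have le: "norm (\<Sum>\<^sub>\<infinity>n. v n l) \<le> (\<Sum>\<^sub>\<infinity>n. norm (v n l))" if "l \<in> \<Lambda>" for l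
    using norm_infsum_bound[OF abs_l[OF that]] .
  have summ: "(\<lambda>l. norm (\<Sum>\<^sub>\<infinity>n. v n l)) summable_on \<Lambda>"
    using outer le by (rule Infinite_Sum.abs_summable_on_comparison_test')
  \<comment> \<open>Domination by \<open>B\<close> makes the series of the \<open>y n\<close>
    absolutely convergent, so its unordered sum exists and agrees with the ordered limit
    \<open>x\<close>.\<close>
  have "(\<lambda>n. norm (y n)) summable_on UNIV"
  proof (rule Infinite_Sum.abs_summable_on_comparison_test')
    show "B summable_on UNIV" using Bsum by (auto simp: summable_on_def)
    show "norm (y n) \<le> B n" for n
      using norm_has_sum_bound[OF has_sum_infsum[OF v(2)] v(4), of n] v(3)[of n] by linarith
  qed
  then have "(y has_sum (\<Sum>\<^sub>\<infinity>n. y n)) UNIV"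
    by (rule has_sum_infsum[OF abs_summable_summable])
  then have ysum: "(y has_sum x) UNIV"
    using sums_unique2[OF has_sum_imp_sums y] by simp
  \<comment> \<open>Summed row by row, the double family gives \<open>x\<close>; after the swap
    below, summing over \<open>n\<close> first must give \<open>x\<close> too.\<close>
  have full: "((\<lambda>(n, l). v n l) has_sum x) (UNIV \<times> \<Lambda>)"
    by (rule has_sum_SigmaI[where g = y]) (use v(4) ysum abs_summable_summable[OF abs] in auto)
  have full': "((\<lambda>(l, n). v n l) has_sum x) (\<Lambda> \<times> UNIV)"
    using iffD1[OF has_sum_swap full] by simp
  show ?thesis
  proof (rule abs_repI)
    show "(\<Sum>\<^sub>\<infinity>n. v n l) \<in> X l" if "l \<in> \<Lambda>" for l
      by (rule has_sum_in_closed_subspace[OF sub cl v(1) inner]) (rule that)+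
    show "((\<lambda>l. \<Sum>\<^sub>\<infinity>n. v n l) has_sum x) \<Lambda>"
      by (rule has_sum_SigmaD[OF full']) (use inner in auto)
    have "(\<Sum>\<^sub>\<infinity>l\<in>\<Lambda>. norm (\<Sum>\<^sub>\<infinity>n. v n l)) \<le> (\<Sum>\<^sub>\<infinity>l\<in>\<Lambda>. \<Sum>\<^sub>\<infinity>n. norm (v n l))"
      using summ outer le by (rule infsum_mono)
    also have "\<dots> = (\<Sum>\<^sub>\<infinity>n. \<Sum>\<^sub>\<infinity>l\<in>\<Lambda>. norm (v n l))"
      by (rule infsum_swap_banach) (use abs' in \<open>simp add: case_prod_unfold\<close>)
    also have "\<dots> \<le> S"
      using has_sum_mono[OF has_sum_infsum[OF N] Bsum] v(3) by blast
    finally show "(\<Sum>\<^sub>\<infinity>l\<in>\<Lambda>. norm (\<Sum>\<^sub>\<infinity>n. v n l)) \<le> S" .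
  qed (rule summ)
qed

text \<open>Applying the approximation again to the error shrinks it by the factor \<open>q\<close>
  each time. The corrections add up to \<open>x\<close>, and their bounds form a geometric series,
  whence \<open>C / (1 - q)\<close>.\<close>

lemma abs_rep_of_approx:
  fixes X :: "'i \<Rightarrow> 'a::banach set"
  assumes sub: "\<And>l. l \<in> \<Lambda> \<Longrightarrow> subspace (X l)" and cl: "\<And>l. l \<in> \<Lambda> \<Longrightarrow> closed (X l)"
    and q: "0 \<le> q" "q < 1" and C: "0 \<le> C"
    and approx: "\<And>x. \<exists>y. abs_rep \<Lambda> X y (C * norm x) \<and> norm (x - y) \<le> q * norm x"
  shows "abs_rep \<Lambda> X x (C / (1 - q) * norm x)"
proof -
  obtain g where g: "\<And>x. abs_rep \<Lambda> X (g x) (C * norm x)" "\<And>x. norm (x - g x) \<le> q * norm x"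
    using approx by metis
  \<comment> \<open>\<open>r n\<close> is the error left after \<open>n\<close> corrections, and
    \<open>g (r n)\<close> is the next correction.\<close>
  define r where "r n = ((\<lambda>z. z - g z) ^^ n) x" for n
  have r0: "r 0 = x" and rSuc: "r (Suc n) = r n - g (r n)" for n
    by (simp_all add: r_def)
  have rn: "norm (r n) \<le> q ^ n * norm x" for n
  proof (induction n)
    case (Suc n)
    have "norm (r (Suc n)) \<le> q * norm (r n)"
      unfolding rSuc by (rule g(2))
    also have "\<dots> \<le> q * (q ^ n * norm x)"
      using Suc q by (intro mult_left_mono)
    finally show ?case by simp
  qed (simp add: r0)
  have "(\<lambda>n. q ^ n * norm x) \<longlonglongrightarrow> 0"
    using tendsto_mult_left_zero[OF LIMSEQ_power_zero[of q]] q by simp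
  then have "r \<longlonglongrightarrow> 0"
    by (rule Lim_null_comparison[rotated]) (use rn in auto)
  \<comment> \<open>The differences of consecutive errors are exactly the corrections
    \<open>g (r n)\<close>.\<close>
  then have "(\<lambda>n. r n - r (Suc n)) sums (r 0 - 0)"
    by (rule telescope_sums')
  then have sums_x: "(\<lambda>n. g (r n)) sums x"
    by (simp add: r0 rSuc)
  have geo: "(\<lambda>n. C * (q ^ n * norm x)) sums (C * (1 / (1 - q) * norm x))"
    by (intro sums_mult sums_mult2 geometric_sums) (use q in auto)
  have "abs_rep \<Lambda> X (g (r n)) (C * (q ^ n * norm x))" for n
  proof -
    have "C * norm (r n) \<le> C * (q ^ n * norm x)"
      using rn C by (rule mult_left_mono)
    with g(1) show ?thesis
      by (rule abs_rep_mono)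
  qed
  from abs_rep_suminf[OF sub cl this geo sums_x] show ?thesis by simp
qed

section \<open>A uniform bound from the Baire category theorem\<close>

text \<open>The sets \<open>A n\<close> cover the space, so the closure of one of them contains a
  ball. Subtracting its centre and rescaling approximates every \<open>x\<close> up to half its
  norm, with a linear bound; successive approximation then makes this exact.\<close>

lemma abs_rep_uniform_bound:
  fixes X :: "'i \<Rightarrow> 'a::banach set"
  assumes sub: "\<And>l. l \<in> \<Lambda> \<Longrightarrow> subspace (X l)" and cl: "\<And>l. l \<in> \<Lambda> \<Longrightarrow> closed (X l)"
    and rep: "\<And>x. \<exists>B. abs_rep \<Lambda> X x B"
  shows "\<exists>C>0. \<forall>x. abs_rep \<Lambda> X x (C * norm x)"
proof -
  define A where "A n = {x. abs_rep \<Lambda> X x (real n)}" for n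
  have "x \<in> (\<Union>n. A n)" for x
  proof -
    obtain B where B: "abs_rep \<Lambda> X x B" using rep by blast
    have "B \<le> real (nat \<lceil>B\<rceil>)" by linarith
    with B have "abs_rep \<Lambda> X x (real (nat \<lceil>B\<rceil>))"
      by (rule abs_rep_mono)
    then show ?thesis by (auto simp: A_def)
  qed
  then have cover: "(\<Union>n. closure (A n)) = UNIV"
    using closure_subset by fastforce
  have "\<exists>n. interior (closure (A n)) \<noteq> {}"
  proof (rule ccontr)
    assume "\<not> ?thesis"
    \<comment> \<open>Countably many closed sets with empty interior would have a union with empty
      interior, but here the union is the whole space.\<close>
    then have "(euclidean :: 'a topology) interior_of \<Union>(range (\<lambda>n. closure (A n))) = {}"
      by (intro Baire_category_alt disjI1 completely_metrizable_space_euclidean) auto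
    then show False using cover by simp
  qed
  then obtain n x0 where "x0 \<in> interior (closure (A n))" by blast
  then obtain d where d: "d > 0" "ball x0 d \<subseteq> closure (A n)"
    unfolding mem_interior by blast
  have approx: "\<exists>y. abs_rep \<Lambda> X y (4 * real n / d * norm x) \<and> norm (x - y) \<le> 1 / 2 * norm x" for x
  proof (cases "x = 0")
    case True
    then show ?thesis using abs_rep_zero[OF sub] by auto
  next
    case False
    \<comment> \<open>This scaling places \<open>x0 + c *\<^sub>R x\<close> at distance
      \<open>d / 2\<close> from \<open>x0\<close>, inside the ball.\<close>
    define c where "c = d / (2 * norm x)"
    have c: "c > 0" "c * norm x = d / 2" using d False by (simp_all add: c_def)
    have "x0 + c *\<^sub>R x \<in> closure (A n)" "x0 \<in> closure (A n)"
      using d c by (auto intro!: subsetD[OF d(2)] simp: dist_norm)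
    \<comment> \<open>Two errors of \<open>d / 8\<close> add up to \<open>d / 4\<close>, which is
      half of the norm \<open>d / 2\<close> of \<open>c *\<^sub>R x\<close>; hence the factor
      1/2.\<close>
    then obtain a b where ab: "a \<in> A n" "dist a (x0 + c *\<^sub>R x) < d / 8" "b \<in> A n" "dist b x0 < d / 8"
      using d(1) unfolding closure_approachable by (meson divide_pos_pos zero_less_numeral)
    have "norm ((b - x0) - (a - (x0 + c *\<^sub>R x))) \<le> norm (b - x0) + norm (a - (x0 + c *\<^sub>R x))"
      by (rule norm_triangle_ineq4)
    also have "\<dots> \<le> d / 4"
      using ab by (simp add: dist_norm)
    finally have err: "norm (c *\<^sub>R x - (a - b)) \<le> d / 4"
      by (simp add: algebra_simps)
    \<comment> \<open>Both \<open>a\<close> and \<open>b\<close> have bound \<open>n\<close>, so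
      their difference has bound \<open>2 * n\<close>; division by \<open>c\<close> makes the bound
      linear in \<open>norm x\<close>.\<close>
    have "abs_rep \<Lambda> X (inverse c *\<^sub>R (a - b)) (inverse c * (real n + real n))"
      using ab c(1) by (intro abs_rep_scaleR abs_rep_diff sub) (auto simp: A_def)
    moreover have "inverse c * (real n + real n) = 4 * real n / d * norm x"
      using d False by (simp add: c_def field_simps)
    moreover have "norm (x - inverse c *\<^sub>R (a - b)) \<le> 1 / 2 * norm x"
    proof -
      have "x - inverse c *\<^sub>R (a - b) = inverse c *\<^sub>R (c *\<^sub>R x - (a - b))"
        using c(1) by (simp add: scaleR_diff_right)
      then have "norm (x - inverse c *\<^sub>R (a - b)) = inverse c * norm (c *\<^sub>R x - (a - b))"
        using c(1) by simp
      also have "\<dots> \<le> inverse c * (d / 4)"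
        using err c(1) by (intro mult_left_mono) auto
      also have "\<dots> = 1 / 2 * norm x"
        using d False by (simp add: c_def field_simps)
      finally show ?thesis .
    qed
    ultimately show ?thesis by metis
  qed
  have bd: "abs_rep \<Lambda> X x (4 * real n / d / (1 - 1 / 2) * norm x)" for x
    by (rule abs_rep_of_approx[OF sub cl _ _ _ approx]) (use d in auto)
  show ?thesis
  proof (intro exI conjI allI)
    \<comment> \<open>With \<open>q = 1 / 2\<close> the constant \<open>4 * n / d\<close> doubles.
      The added 1 keeps it positive when \<open>n = 0\<close>.\<close>
    show "8 * real n / d + 1 > 0" using d by (simp add: add_nonneg_pos)
    show "abs_rep \<Lambda> X x ((8 * real n / d + 1) * norm x)" for x
    proof -
      have "4 * real n / d / (1 - 1 / 2) * norm x \<le> (8 * real n / d + 1) * norm x"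
        by (intro mult_right_mono) auto
      with bd show ?thesis
        by (rule abs_rep_mono)
    qed
  qed
qed

section \<open>Properties of the one-sided gap\<close>

text \<open>The distance to \<open>Z\<close> need not be attained, but the strict inequality leaves
  room for an actual point of \<open>Z\<close> near the unit vector \<open>e\<close>. Homogeneity
  carries it over to \<open>y\<close>.\<close>

lemma rho0_approx:
  fixes Y Z :: "'a::real_normed_vector set"
  assumes Y: "subspace Y" and Z: "subspace Z" and r: "rho0 Y Z < r" and y: "y \<in> Y"
  obtains z where "z \<in> Z" "norm (y - z) \<le> r * norm y"
proof (cases "y = 0")
  case True
  then show ?thesis using that[of 0] subspace_0[OF Z] by simp
next
  case False
  define e where "e = y /\<^sub>R norm y"
  have e: "e \<in> Y" "norm e = 1" and ye: "y = norm y *\<^sub>R e"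
    using Y y False by (auto simp: e_def intro: subspace_scale)
  have "infdist y Z \<le> 1" if "norm y = 1" for y
    using infdist_le[OF subspace_0[OF Z], of y] that by simp
  then have bdd: "bdd_above ((\<lambda>y. infdist y Z) ` {y \<in> Y. norm y = 1})"
    by (intro bdd_aboveI2[where M = 1]) auto
  have "infdist e Z \<le> (SUP y\<in>{y \<in> Y. norm y = 1}. infdist y Z)"
    by (rule cSUP_upper[OF _ bdd]) (use e in auto)
  also have "\<dots> < r"
    using r y False by (auto simp: rho0_def split: if_splits)
  finally have "(INF z\<in>Z. dist e z) < r"
    using subspace_0[OF Z] by (auto simp: infdist_def split: if_splits)
  then obtain z where z: "z \<in> Z" "dist e z < r"
    using subspace_0[OF Z] by (subst (asm) cINF_less_iff) auto
  have "y - norm y *\<^sub>R z = norm y *\<^sub>R (e - z)"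
    using ye by (simp add: scaleR_diff_right)
  then have "norm (y - norm y *\<^sub>R z) = norm y * dist e z"
    by (simp add: dist_norm)
  also have "\<dots> \<le> r * norm y"
    using mult_left_mono[of "dist e z" r "norm y"] z(2) by (simp add: mult.commute)
  finally show ?thesis
    using that[of "norm y *\<^sub>R z"] z(1) Z subspace_scale by blast
qed

text \<open>Since 0 lies in \<open>Z\<close>, unit vectors have distance at most 1 from
  \<open>Z\<close>. The upper bound ensures that the supremum over the index set dominates every
  gap; the lower one makes any number above a gap nonnegative.\<close>

lemma rho0_bounds:
  fixes Y Z :: "'a::real_normed_vector set"
  assumes Y: "subspace Y" and Z: "subspace Z"
  shows "0 \<le> rho0 Y Z" "rho0 Y Z \<le> 1"
proof -
  \<comment> \<open>A unit vector makes the set under the supremum nonempty, as both estimates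
    require.\<close>
  have *: "\<exists>y\<in>Y. norm y = 1" if "Y \<noteq> {0}"
  proof -
    have "\<not> Y \<subseteq> {0}" using that subspace_0[OF Y] by auto
    then obtain y where "y \<in> Y" "y \<noteq> 0" by auto
    then show ?thesis
      using Y by (intro bexI[of _ "y /\<^sub>R norm y"]) (auto intro: subspace_scale)
  qed
  have le: "infdist y Z \<le> 1" if "norm y = 1" for y
    using infdist_le[OF subspace_0[OF Z], of y] that by (simp add: dist_norm)
  show "rho0 Y Z \<le> 1"
    using * le by (auto simp: rho0_def intro!: cSUP_least)
  show "0 \<le> rho0 Y Z"
  proof (cases "Y = {0}")
    case False
    then obtain y where "y \<in> {y \<in> Y. norm y = 1}" using * by blast
    moreover have "bdd_above ((\<lambda>y. infdist y Z) ` {y \<in> Y. norm y = 1})"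
      by (rule bdd_aboveI2[where M = 1]) (use le in auto)
    ultimately have "0 \<le> (SUP y\<in>{y \<in> Y. norm y = 1}. infdist y Z)"
      by (intro cSUP_upper2[where x = y] infdist_nonneg)
    then show ?thesis using False by (simp add: rho0_def)
  qed (simp add: rho0_def)
qed

section \<open>Perturbation of the subspaces\<close>

text \<open>Each term \<open>u l\<close> is replaced by a nearby \<open>v l\<close> in
  \<open>X' l\<close>. This changes its norm by at most \<open>r * norm (u l)\<close>, and the
  changes sum to at most \<open>r * B\<close>.\<close>

lemma abs_rep_perturb:
  fixes X X' :: "'i \<Rightarrow> 'a::banach set"
  assumes "r \<ge> 0"
    and close: "\<And>l y. l \<in> \<Lambda> \<Longrightarrow> y \<in> X l \<Longrightarrow> \<exists>z\<in>X' l. norm (y - z) \<le> r * norm y"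
    and rep: "abs_rep \<Lambda> X x B"
  shows "\<exists>y. abs_rep \<Lambda> X' y ((1 + r) * B) \<and> norm (x - y) \<le> r * B"
proof -
  obtain u where u: "\<And>l. l \<in> \<Lambda> \<Longrightarrow> u l \<in> X l" "(\<lambda>l. norm (u l)) summable_on \<Lambda>"
    "(\<Sum>\<^sub>\<infinity>l\<in>\<Lambda>. norm (u l)) \<le> B" "(u has_sum x) \<Lambda>"
    using rep unfolding abs_rep_def by blast
  have "\<forall>l\<in>\<Lambda>. \<exists>z. z \<in> X' l \<and> norm (u l - z) \<le> r * norm (u l)"
    using close u(1) by blast
  then obtain v where v: "\<And>l. l \<in> \<Lambda> \<Longrightarrow> v l \<in> X' l"
      "\<And>l. l \<in> \<Lambda> \<Longrightarrow> norm (u l - v l) \<le> r * norm (u l)"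
    by metis
  have vn: "norm (v l) \<le> (1 + r) * norm (u l)" if "l \<in> \<Lambda>" for l
    using v(2)[OF that] norm_triangle_ineq2[of "v l" "u l"]
    by (simp add: algebra_simps norm_minus_commute)
  have s: "(\<lambda>l. c * norm (u l)) summable_on \<Lambda>" for c
    using u(2) by (rule summable_on_cmult_right)
  have vs: "(\<lambda>l. norm (v l)) summable_on \<Lambda>"
    by (rule Infinite_Sum.abs_summable_on_comparison_test'[OF s vn])
  have ds: "(\<lambda>l. norm (u l - v l)) summable_on \<Lambda>"
    by (rule Infinite_Sum.abs_summable_on_comparison_test'[OF s v(2)])
  have vx: "(v has_sum infsum v \<Lambda>) \<Lambda>"
    using vs by (rule has_sum_infsum[OF abs_summable_summable])
  have "abs_rep \<Lambda> X' (infsum v \<Lambda>) ((1 + r) * B)"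
  proof (rule abs_repI[OF v(1) vs _ vx])
    have "(\<Sum>\<^sub>\<infinity>l\<in>\<Lambda>. norm (v l)) \<le> (\<Sum>\<^sub>\<infinity>l\<in>\<Lambda>. (1 + r) * norm (u l))"
      using vs s vn by (rule infsum_mono)
    also have "\<dots> = (1 + r) * (\<Sum>\<^sub>\<infinity>l\<in>\<Lambda>. norm (u l))"
      using u(2) by (simp add: infsum_cmult_right)
    also have "\<dots> \<le> (1 + r) * B"
      using u(3) \<open>r \<ge> 0\<close> by (intro mult_left_mono) auto
    finally show "(\<Sum>\<^sub>\<infinity>l\<in>\<Lambda>. norm (v l)) \<le> (1 + r) * B" .
  qed
  moreover have "norm (x - infsum v \<Lambda>) \<le> r * B"
  proof -
    have "((\<lambda>l. u l - v l) has_sum (x - infsum v \<Lambda>)) \<Lambda>"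
      using has_sum_add[OF u(4) has_sum_scaleR[OF vx, of "-1"]] by simp
    then have "norm (x - infsum v \<Lambda>) \<le> (\<Sum>\<^sub>\<infinity>l\<in>\<Lambda>. norm (u l - v l))"
      by (rule norm_has_sum_bound[OF has_sum_infsum[OF ds]])
    also have "\<dots> \<le> (\<Sum>\<^sub>\<infinity>l\<in>\<Lambda>. r * norm (u l))"
      using ds s v(2) by (rule infsum_mono)
    also have "\<dots> = r * (\<Sum>\<^sub>\<infinity>l\<in>\<Lambda>. norm (u l))"
      using u(2) by (simp add: infsum_cmult_right)
    also have "\<dots> \<le> r * B"
      using u(3) \<open>r \<ge> 0\<close> by (intro mult_left_mono)
    finally show ?thesis .
  qed
  ultimately show ?thesis by blast
qed

text \<open>Restricting scalars to the reals reduces the argument to real subspaces, since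
  representations involve only membership, norms and sums.\<close>

lemma (in banach_space_over) closed_subspace_imp_real:
  assumes "closed_subspace smul Y"
  shows "Real_Vector_Spaces.subspace Y" "closed Y"
proof -
  have Y: "subspace Y" and "closed Y" using assms by (auto simp: closed_subspace_def)
  then show "closed Y" by blast
  show "Real_Vector_Spaces.subspace Y"
    using Y subspace_scale[OF Y, of _ "of_real _"]
    by (auto simp: Real_Vector_Spaces.subspace_def subspace_0 subspace_add scale_of_real)
qed

lemma arfs_iff_abs_rep:
  "arfs smul \<Lambda> X \<longleftrightarrow> (\<forall>l\<in>\<Lambda>. closed_subspace smul (X l)) \<and> (\<forall>x. \<exists>B. abs_rep \<Lambda> X x B)"
  unfolding arfs_def abs_rep_def by blast

theorem theorem4p3:
  fixes smul :: "'k::real_normed_field \<Rightarrow> 'a::banach \<Rightarrow> 'a"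
    and \<Lambda> :: "'i set"
    and X :: "'i \<Rightarrow> 'a set"
  assumes "banach_space_over smul"
    and "\<Lambda> \<noteq> {}"
    and "arfs smul \<Lambda> X"
  shows "\<exists>R>0. \<forall>X'. (\<forall>l\<in>\<Lambda>. closed_subspace smul (X' l)) \<longrightarrow>
           (SUP l\<in>\<Lambda>. rho0 (X l) (X' l)) < R \<longrightarrow> arfs smul \<Lambda> X'"
proof -
  note real = banach_space_over.closed_subspace_imp_real[OF assms(1)]
  have X: "subspace (X l)" "closed (X l)" if "l \<in> \<Lambda>" for l
    using assms(3) that real by (auto simp: arfs_def)
  have "\<exists>B. abs_rep \<Lambda> X x B" for x
    using assms(3) by (simp add: arfs_iff_abs_rep)
  with X have "\<exists>C>0. \<forall>x. abs_rep \<Lambda> X x (C * norm x)"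
    by (rule abs_rep_uniform_bound)
  then obtain C where C: "C > 0" "\<And>x. abs_rep \<Lambda> X x (C * norm x)"
    by blast
  \<comment> \<open>The choice \<open>R = 1 / C\<close> makes the error factor \<open>r * C\<close>
    less than 1.\<close>
  have "arfs smul \<Lambda> X'"
    if cs: "\<forall>l\<in>\<Lambda>. closed_subspace smul (X' l)"
      and lt: "(SUP l\<in>\<Lambda>. rho0 (X l) (X' l)) < 1 / C" for X'
  proof -
    have X': "subspace (X' l)" "closed (X' l)" if "l \<in> \<Lambda>" for l
      using cs that real by auto
    \<comment> \<open>An intermediate \<open>r\<close> bounds all gaps strictly and uniformly, while
      \<open>r * C < 1\<close> still holds.\<close>
    obtain r where r: "(SUP l\<in>\<Lambda>. rho0 (X l) (X' l)) < r" "r < 1 / C"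
      using dense[OF lt] by blast
    have bdd: "bdd_above ((\<lambda>l. rho0 (X l) (X' l)) ` \<Lambda>)"
      by (rule bdd_aboveI2[where M = 1]) (use rho0_bounds(2)[OF X(1) X'(1)] in auto)
    have rho: "rho0 (X l) (X' l) < r" if "l \<in> \<Lambda>" for l
      using cSUP_upper[OF that bdd] r(1) by linarith
    \<comment> \<open>A single index suffices: its gap is nonnegative and lies below
      \<open>r\<close>.\<close>
    obtain l0 where "l0 \<in> \<Lambda>" using \<open>\<Lambda> \<noteq> {}\<close> by blast
    then have r0: "0 \<le> r"
      using rho0_bounds(1)[OF X(1) X'(1)] rho by (meson less_imp_le order_trans)
    have close: "\<exists>z\<in>X' l. norm (y - z) \<le> r * norm y" if "l \<in> \<Lambda>" "y \<in> X l" for l y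
      by (rule rho0_approx[OF X(1) X'(1) rho]) (use that in auto)
    have "\<exists>y. abs_rep \<Lambda> X' y ((1 + r) * C * norm x) \<and> norm (x - y) \<le> r * C * norm x" for x
      using abs_rep_perturb[OF r0 close C(2)] by (simp add: mult.assoc)
    moreover have "r * C < 1" "0 \<le> r * C" "0 \<le> (1 + r) * C"
      using r(2) r0 C(1) by (simp_all add: field_simps)
    \<comment> \<open>Successive approximation is now run in the perturbed family, with
      \<open>q = r * C\<close>.\<close>
    ultimately have "abs_rep \<Lambda> X' x ((1 + r) * C / (1 - r * C) * norm x)" for x
      by (intro abs_rep_of_approx X')
    then show ?thesis
      using cs unfolding arfs_iff_abs_rep by blast
  qed
  then show ?thesis
    using C(1) by (intro exI[of _ "1 / C"]) simp
qed

end
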